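(* Let $f(\cdot;\boldsymbol\lambda)$ and $\psi(\cdot;\boldsymbol\theta)$, $\boldsymbol\theta\in\boldsymbol\Theta\subset\mathbb R^d$, be probability densities on $\mathcal X\subset\mathbb R^s$, with $\boldsymbol\lambda$ fixed and known. Assume that $\mathbb C(\boldsymbol\theta,\boldsymbol\theta)<\infty$ for all $\boldsymbol\theta\in\boldsymbol\Theta$ and that $\mathrm{supp}[\psi(\cdot;\boldsymbol\theta)]\subset\mathrm{supp}[f(\cdot;\boldsymbol\lambda)]$ for each $\boldsymbol\theta\in\boldsymbol\Theta$, where $\mathbb C$ is the covariance function defined in the context. Let $S(\boldsymbol\theta)$ and $S^\star(\boldsymbol\theta)$ be the score process and normalized score process computed from an i.i.d. sample $X_1,\dots,X_n$ with density $p(x;\eta,\boldsymbol\theta_0)=(1-\eta)f(x;\boldsymbol\lambda)+\eta\,\psi(x;\boldsymbol\theta_0)$. Then: (1) Under $\mathcal H_0$ ($\eta=0$), $\mathbb E[S(\boldsymbol\theta)]=0$ for all $\boldsymbol\theta$, and $\mathrm{cov}[S(\boldsymbol\theta),S(\boldsymbol\theta^\dagger)]=n\,\mathbb C(\boldsymbol\theta,\boldsymbol\theta^\dagger)$ for all $\boldsymbol\theta,\boldsymbol\theta^\dagger\in\boldsymbol\Theta$. (2) Under $\mathcal H_1$ ($\eta>0$, with true perturbation parameter $\boldsymbol\theta_0\in\boldsymbol\Theta$), $\mathbb E[S(\boldsymbol\theta)]=n\,\eta\,\mathbb C(\boldsymbol\theta,\boldsymbol\theta_0)$. (3) Under $\mathcal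 H_1$, for every $\boldsymbol\theta$ at which $S^\star(\boldsymbol\theta)$ is defined, $$\mathbb E[S^\star(\boldsymbol\theta)]=\sqrt n\,\eta\,\frac{\mathbb C(\boldsymbol\theta,\boldsymbol\theta_0)}{\sqrt{\mathbb C(\boldsymbol\theta,\boldsymbol\theta)}}\le\eta\sqrt{n\,\mathbb C(\boldsymbol\theta_0,\boldsymbol\theta_0)},$$ with equality at $\boldsymbol\theta=\boldsymbol\theta_0$.
   Context: Perturbation model: $p(x;\eta,\boldsymbol\theta)=(1-\eta)f(x;\boldsymbol\lambda)+\eta\,\psi(x;\boldsymbol\theta)$ with $\eta\in[0,1]$; the hypotheses are $\mathcal H_0:\eta=0$ and $\mathcal H_1:\eta>0$. Score process: $S(\boldsymbol\theta)=\sum_{i=1}^n\left[\frac{\psi(X_i;\boldsymbol\theta)}{f(X_i;\boldsymbol\lambda)}-1\right]$. Covariance function: $$\mathbb C(\boldsymbol\theta,\boldsymbol\theta^\dagger)=\int\frac{[\psi(x;\boldsymbol\theta)-f(x;\boldsymbol\lambda)][\psi(x;\boldsymbol\theta^\dagger)-f(x;\boldsymbol\lambda)]}{f(x;\boldsymbol\lambda)}\,dx=\int\frac{\psi(x;\boldsymbol\theta)\psi(x;\boldsymbol\theta^\dagger)}{f(x;\boldsymbol\lambda)}\,dx-1.$$ Normalized score process: $S^\star(\boldsymbol\theta)=S(\boldsymbol\theta)/\sqrt{n\,\mathbb C(\boldsymbol\theta,\boldsymbol\theta)}$, defined where $\mathbb C(\boldsymbol\theta,\boldsymbol\theta)>0$.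 Here $\mathrm{supp}$ denotes the support of a density. *)

theory Defs
  imports "HOL-Probability.Probability"
begin

text \<open>
  Densities are taken with respect to Lebesgue measure on the sample space, i.e. to
  \<open>restrict_space lborel \<X>\<close>. The null density \<open>f\<close> stands for \<open>f(\<cdot>;\<lambda>)\<close> with \<open>\<lambda>\<close> fixed,
  and \<open>\<psi> x \<theta>\<close> for \<open>\<psi>(x;\<theta>)\<close>.
\<close>

definition prob_density_on :: "'a::euclidean_space set \<Rightarrow> ('a \<Rightarrow> real) \<Rightarrow> bool" where
  "prob_density_on \<X> g \<longleftrightarrow>
     g \<in> borel_measurable (restrict_space lborel \<X>) \<and>
     (\<forall>x\<in>\<X>. 0 \<le> g x) \<and>
     (\<integral>\<^sup>+x. ennreal (g x) \<partial>restrict_space lborel \<X>) = 1"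

text \<open>
  The topological support. The inclusion of supports so understood is implied by the
  inclusion of the sets on which the densities are nonzero, so it is the weaker hypothesis.
\<close>

definition density_supp :: "'a::euclidean_space set \<Rightarrow> ('a \<Rightarrow> real) \<Rightarrow> 'a set" where
  "density_supp \<X> g = closure (support_on \<X> g)"

definition perturbed :: "('a \<Rightarrow> real) \<Rightarrow> ('a \<Rightarrow> 'b \<Rightarrow> real) \<Rightarrow> real \<Rightarrow> 'b \<Rightarrow> 'a \<Rightarrow> real" where
  "perturbed f \<psi> \<eta> \<theta> x = (1 - \<eta>) * f x + \<eta> * \<psi> x \<theta>"

definition score_cov ::
    "'a::euclidean_space set \<Rightarrow> ('a \<Rightarrow> real) \<Rightarrow> ('a \<Rightarrow> 'b \<Rightarrow> real) \<Rightarrow> 'b \<Rightarrow> 'b \<Rightarrow> real" where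
  "score_cov \<X> f \<psi> \<theta> \<theta>' =
     (\<integral>x. (\<psi> x \<theta> - f x) * (\<psi> x \<theta>' - f x) / f x \<partial>restrict_space lborel \<X>)"

text \<open>
  The diagonal of \<open>score_cov\<close> as an integral with values in \<open>[0, \<infinity>]\<close>, used to express its
  finiteness. Division is that of \<open>ennreal\<close>, so the integrand is \<open>\<infinity>\<close> (and not \<open>0\<close>, as for
  division in \<open>real\<close>) where \<open>f x = 0 < \<psi> x \<theta>\<close>, and \<open>0\<close> where both densities vanish.
\<close>

definition score_cov_diag ::
    "'a::euclidean_space set \<Rightarrow> ('a \<Rightarrow> real) \<Rightarrow> ('a \<Rightarrow> 'b \<Rightarrow> real) \<Rightarrow> 'b \<Rightarrow> ennreal" where
  "score_cov_diag \<X> f \<psi> \<theta> =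
     (\<integral>\<^sup>+x. ennreal ((\<psi> x \<theta> - f x)\<^sup>2) / ennreal (f x) \<partial>restrict_space lborel \<X>)"

definition score ::
    "('a \<Rightarrow> real) \<Rightarrow> ('a \<Rightarrow> 'b \<Rightarrow> real) \<Rightarrow> nat \<Rightarrow> (nat \<Rightarrow> '\<omega> \<Rightarrow> 'a) \<Rightarrow> 'b \<Rightarrow> '\<omega> \<Rightarrow> real" where
  "score f \<psi> n X \<theta> \<omega> = (\<Sum>i=1..n. (\<psi> (X i \<omega>) \<theta> / f (X i \<omega>) - 1))"

definition norm_score ::
    "'a::euclidean_space set \<Rightarrow> ('a \<Rightarrow> real) \<Rightarrow> ('a \<Rightarrow> 'b \<Rightarrow> real) \<Rightarrow> nat \<Rightarrow>
     (nat \<Rightarrow> '\<omega> \<Rightarrow> 'a) \<Rightarrow> 'b \<Rightarrow> '\<omega> \<Rightarrow> real" where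
  "norm_score \<X> f \<psi> n X \<theta> \<omega> =
     score f \<psi> n X \<theta> \<omega> / sqrt (real n * score_cov \<X> f \<psi> \<theta> \<theta>)"

definition iid_sample ::
    "'\<omega> measure \<Rightarrow> 'a::euclidean_space set \<Rightarrow> ('a \<Rightarrow> real) \<Rightarrow> nat \<Rightarrow> (nat \<Rightarrow> '\<omega> \<Rightarrow> 'a) \<Rightarrow> bool" where
  "iid_sample M \<X> p n X \<longleftrightarrow>
     prob_space.indep_vars M (\<lambda>_. restrict_space lborel \<X>) X {1..n} \<and>
     (\<forall>i\<in>{1..n}. distributed M (restrict_space lborel \<X>) (X i) (\<lambda>x. ennreal (p x)))"

definition covariance :: "'\<omega> measure \<Rightarrow> ('\<omega> \<Rightarrow> real) \<Rightarrow> ('\<omega> \<Rightarrow> real) \<Rightarrow> real" where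
  "covariance M U V =
     (\<integral>\<omega>. (U \<omega> - (\<integral>\<omega>'. U \<omega>' \<partial>M)) * (V \<omega> - (\<integral>\<omega>'. V \<omega>' \<partial>M)) \<partial>M)"

lemma score_cov_diag_finiteD:
  assumes f: "prob_density_on \<X> f" and g: "prob_density_on \<X> (\<lambda>x. \<psi> x \<theta>)"
    and fin: "score_cov_diag \<X> f \<psi> \<theta> < \<infinity>"
  shows "AE x in restrict_space lborel \<X>. f x = 0 \<longrightarrow> \<psi> x \<theta> = 0"
    and "integrable (restrict_space lborel \<X>) (\<lambda>x. (\<psi> x \<theta> - f x)\<^sup>2 / f x)"
    and "score_cov_diag \<X> f \<psi> \<theta> = ennreal (score_cov \<X> f \<psi> \<theta> \<theta>)"
proof -
  let ?N = "restrict_space lborel \<X>"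
  have [measurable]: "f \<in> borel_measurable ?N" "(\<lambda>x. \<psi> x \<theta>) \<in> borel_measurable ?N"
    using f g by (auto simp: prob_density_on_def)
  have nn: "\<And>x. x \<in> space ?N \<Longrightarrow> 0 \<le> f x"
    using f by (auto simp: prob_density_on_def space_restrict_space)
  have "AE x in ?N. ennreal ((\<psi> x \<theta> - f x)\<^sup>2) / ennreal (f x) \<noteq> \<infinity>"
    using fin by (intro nn_integral_noteq_infinite) (auto simp: score_cov_diag_def)
  then show ae: "AE x in ?N. f x = 0 \<longrightarrow> \<psi> x \<theta> = 0"
    by eventually_elim (auto simp: divide_ennreal_def ennreal_mult_eq_top_iff)
  have "AE x in ?N. ennreal ((\<psi> x \<theta> - f x)\<^sup>2) / ennreal (f x)
      = ennreal ((\<psi> x \<theta> - f x)\<^sup>2 / f x)"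
    using ae AE_space
  proof eventually_elim
    case (elim x)
    with nn[of x] show ?case
      by (cases "f x = 0") (auto simp: divide_ennreal)
  qed
  then have eq: "score_cov_diag \<X> f \<psi> \<theta> = (\<integral>\<^sup>+x. ennreal ((\<psi> x \<theta> - f x)\<^sup>2 / f x) \<partial>?N)"
    unfolding score_cov_diag_def by (rule nn_integral_cong_AE)
  have pos: "AE x in ?N. 0 \<le> (\<psi> x \<theta> - f x)\<^sup>2 / f x"
    using nn by (intro AE_I2) auto
  show int: "integrable ?N (\<lambda>x. (\<psi> x \<theta> - f x)\<^sup>2 / f x)"
    by (rule integrableI_nonneg) (use fin eq pos in auto)
  show "score_cov_diag \<X> f \<psi> \<theta> = ennreal (score_cov \<X> f \<psi> \<theta> \<theta>)"
    using nn_integral_eq_integral[OF int pos] by (simp add: eq score_cov_def power2_eq_square)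
qed

lemma
  assumes f: "prob_density_on \<X> f"
    and g: "prob_density_on \<X> (\<lambda>x. \<psi> x \<theta>)" and g': "prob_density_on \<X> (\<lambda>x. \<psi> x \<theta>')"
    and fin: "score_cov_diag \<X> f \<psi> \<theta> < \<infinity>" and fin': "score_cov_diag \<X> f \<psi> \<theta>' < \<infinity>"
  shows score_cov_integrable:
      "integrable (restrict_space lborel \<X>) (\<lambda>x. (\<psi> x \<theta> - f x) * (\<psi> x \<theta>' - f x) / f x)"
    and score_cov_eq:
      "score_cov \<X> f \<psi> \<theta> \<theta>' = (\<integral>x. \<psi> x \<theta> * \<psi> x \<theta>' / f x \<partial>restrict_space lborel \<X>) - 1"
proof -
  let ?N = "restrict_space lborel \<X>"
  have [measurable]: "f \<in> borel_measurable ?N" "(\<lambda>x. \<psi> x \<theta>) \<in> borel_measurable ?N"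
      "(\<lambda>x. \<psi> x \<theta>') \<in> borel_measurable ?N"
    using f g g' by (auto simp: prob_density_on_def)
  have dens: "integrable ?N h" "(\<integral>x. h x \<partial>?N) = 1" if "prob_density_on \<X> h" for h
  proof -
    have "(\<integral>\<^sup>+x. ennreal (h x) \<partial>?N) = ennreal 1" "AE x in ?N. 0 \<le> h x" "h \<in> borel_measurable ?N"
      using that by (auto simp: prob_density_on_def space_restrict_space intro!: AE_I2)
    then have "has_bochner_integral ?N h 1"
      by (intro has_bochner_integral_nn_integral) auto
    then show "integrable ?N h" "(\<integral>x. h x \<partial>?N) = 1"
      by (auto simp: has_bochner_integral_iff)
  qed
  note A = score_cov_diag_finiteD(2)[OF f g fin] score_cov_diag_finiteD(2)[OF f g' fin']
  show int: "integrable ?N (\<lambda>x. (\<psi> x \<theta> - f x) * (\<psi> x \<theta>' - f x) / f x)"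
  proof (rule Bochner_Integration.integrable_bound[OF Bochner_Integration.integrable_add[OF A]])
    show "AE x in ?N. norm ((\<psi> x \<theta> - f x) * (\<psi> x \<theta>' - f x) / f x)
        \<le> norm ((\<psi> x \<theta> - f x)\<^sup>2 / f x + (\<psi> x \<theta>' - f x)\<^sup>2 / f x)"
    proof (rule AE_I2)
      fix x
      have "2 * \<bar>\<psi> x \<theta> - f x\<bar> * \<bar>\<psi> x \<theta>' - f x\<bar> \<le> (\<psi> x \<theta> - f x)\<^sup>2 + (\<psi> x \<theta>' - f x)\<^sup>2"
        using sum_squares_bound[of "\<bar>\<psi> x \<theta> - f x\<bar>" "\<bar>\<psi> x \<theta>' - f x\<bar>"] by simp
      moreover have "0 \<le> \<bar>\<psi> x \<theta> - f x\<bar> * \<bar>\<psi> x \<theta>' - f x\<bar>" by simp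
      ultimately have "\<bar>\<psi> x \<theta> - f x\<bar> * \<bar>\<psi> x \<theta>' - f x\<bar> \<le> (\<psi> x \<theta> - f x)\<^sup>2 + (\<psi> x \<theta>' - f x)\<^sup>2"
        by linarith
      then show "norm ((\<psi> x \<theta> - f x) * (\<psi> x \<theta>' - f x) / f x)
          \<le> norm ((\<psi> x \<theta> - f x)\<^sup>2 / f x + (\<psi> x \<theta>' - f x)\<^sup>2 / f x)"
        by (simp add: abs_mult add_divide_distrib[symmetric] divide_right_mono)
    qed
  qed simp
  have "AE x in ?N. \<psi> x \<theta> * \<psi> x \<theta>' / f x
      = (\<psi> x \<theta> - f x) * (\<psi> x \<theta>' - f x) / f x + (\<psi> x \<theta> + \<psi> x \<theta>' - f x)"
    using score_cov_diag_finiteD(1)[OF f g fin] score_cov_diag_finiteD(1)[OF f g' fin']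
  proof eventually_elim
    case (elim x)
    then show ?case by (cases "f x = 0") (auto simp: field_simps)
  qed
  then have "(\<integral>x. \<psi> x \<theta> * \<psi> x \<theta>' / f x \<partial>?N)
      = (\<integral>x. (\<psi> x \<theta> - f x) * (\<psi> x \<theta>' - f x) / f x + (\<psi> x \<theta> + \<psi> x \<theta>' - f x) \<partial>?N)"
    by (intro integral_cong_AE) auto
  also have "\<dots> = score_cov \<X> f \<psi> \<theta> \<theta>' + 1"
    using int dens[OF f] dens[OF g] dens[OF g'] by (simp add: score_cov_def)
  finally show "score_cov \<X> f \<psi> \<theta> \<theta>'
      = (\<integral>x. \<psi> x \<theta> * \<psi> x \<theta>' / f x \<partial>?N) - 1"
    by simp
qed

end

theory Submission
  imports Defs
begin

text \<open>
  Write \<open>r = \<psi>(\<cdot>;\<theta>)/f - 1\<close>, so that the score is \<open>\<Sum> r(X\<^sub>i)\<close>. Finiteness of \<open>C(\<theta>,\<theta>)\<close> forces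
  \<open>\<psi>(\<cdot>;\<theta>) = 0\<close> almost everywhere on \<open>{f = 0}\<close>, whence
  \<open>p r = \<eta> (\<psi>(\<cdot>;\<theta>) - f) (\<psi>(\<cdot>;\<theta>\<^sub>0) - f) / f + (\<psi>(\<cdot>;\<theta>) - f)\<close> almost everywhere; the last summand
  integrates to \<open>0\<close> and \<open>E[r(X\<^sub>i)] = \<eta> C(\<theta>,\<theta>\<^sub>0)\<close>. For \<open>\<eta> = 0\<close>, independence and centredness kill
  the off-diagonal covariances and \<open>f r r'\<close> is the integrand of \<open>C\<close>. The bound in the third part
  is the Cauchy--Schwarz inequality for \<open>C\<close>.
\<close>

lemma prob_density_onD:
  assumes "prob_density_on \<X> g"
  shows "g \<in> borel_measurable (restrict_space lborel \<X>)"
    and "x \<in> \<X> \<Longrightarrow> 0 \<le> g x"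
    and "integrable (restrict_space lborel \<X>) g"
    and "(\<integral>x. g x \<partial>restrict_space lborel \<X>) = 1"
proof -
  show "g \<in> borel_measurable (restrict_space lborel \<X>)" "x \<in> \<X> \<Longrightarrow> 0 \<le> g x"
    using assms by (auto simp: prob_density_on_def)
  have "has_bochner_integral (restrict_space lborel \<X>) g 1"
    using assms
    by (intro has_bochner_integral_nn_integral)
      (auto simp: prob_density_on_def space_restrict_space intro!: AE_I2)
  then show "integrable (restrict_space lborel \<X>) g"
      "(\<integral>x. g x \<partial>restrict_space lborel \<X>) = 1"
    by (auto simp: has_bochner_integral_iff)
qed

text \<open>The covariance acts as an inner product on deviations from \<open>f\<close>, weighted by
  \<open>1 / f\<close>. Finiteness of both diagonals makes all the entries genuine integrals. A
  nonnegative square then integrates to \<open>a * (a * c - b\<^sup>2)\<close>, and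
  \<open>pos\<close> allows the factor \<open>a\<close> to be cancelled.\<close>

lemma score_cov_Cauchy_Schwarz:
  assumes f: "prob_density_on \<X> f"
    and g: "prob_density_on \<X> (\<lambda>x. \<psi> x \<theta>)" and h: "prob_density_on \<X> (\<lambda>x. \<psi> x \<theta>')"
    and fin: "score_cov_diag \<X> f \<psi> \<theta> < \<infinity>" and fin': "score_cov_diag \<X> f \<psi> \<theta>' < \<infinity>"
    and pos: "0 < score_cov \<X> f \<psi> \<theta> \<theta>"
  shows "(score_cov \<X> f \<psi> \<theta> \<theta>')\<^sup>2 \<le> score_cov \<X> f \<psi> \<theta> \<theta> * score_cov \<X> f \<psi> \<theta>' \<theta>'"
proof -
  let ?N = "restrict_space lborel \<X>"
  define a b c where "a = score_cov \<X> f \<psi> \<theta> \<theta>" and "b = score_cov \<X> f \<psi> \<theta> \<theta>'"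
    and "c = score_cov \<X> f \<psi> \<theta>' \<theta>'"
  define u v where "u = (\<lambda>x. \<psi> x \<theta> - f x)" and "v = (\<lambda>x. \<psi> x \<theta>' - f x)"
  have int: "has_bochner_integral ?N (\<lambda>x. u x * u x / f x) a"
      "has_bochner_integral ?N (\<lambda>x. u x * v x / f x) b"
      "has_bochner_integral ?N (\<lambda>x. v x * v x / f x) c"
    using score_cov_integrable[OF f g g fin fin] score_cov_integrable[OF f g h fin fin']
      score_cov_integrable[OF f h h fin' fin']
    by (simp_all add: has_bochner_integral_iff a_def b_def c_def u_def v_def score_cov_def)
  \<comment> \<open>The combination \<open>a * v - b * u\<close> is \<open>a\<close> times the
    component of \<open>v\<close> orthogonal to \<open>u\<close> in the weighted inner product;
    scaling by \<open>a\<close> avoids dividing by it.\<close>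
  have "0 \<le> (\<integral>x. (a * v x - b * u x)\<^sup>2 / f x \<partial>?N)"
    using prob_density_onD(2)[OF f]
    by (intro integral_nonneg_AE AE_I2) (auto simp: space_restrict_space)
  also have "\<dots> = (\<integral>x. a\<^sup>2 * (v x * v x / f x) - 2 * a * b * (u x * v x / f x)
      + b\<^sup>2 * (u x * u x / f x) \<partial>?N)"
    by (intro Bochner_Integration.integral_cong refl)
      (simp add: power2_eq_square algebra_simps add_divide_distrib diff_divide_distrib)
  also have "\<dots> = a\<^sup>2 * c - 2 * a * b * b + b\<^sup>2 * a"
    by (intro has_bochner_integral_integral_eq has_bochner_integral_add has_bochner_integral_diff
        has_bochner_integral_mult_right int)
  also have "\<dots> = a * (a * c - b\<^sup>2)"
    by (simp add: power2_eq_square algebra_simps)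
  finally show ?thesis
    using pos by (simp add: zero_le_mult_iff a_def b_def c_def)
qed

text \<open>This is the mean of a single score term, computed on the sample space. Writing the
  density as \<open>f + \<eta> * (\<psi>\<^sub>0 - f)\<close>, with \<open>\<psi>\<^sub>0\<close>
  the density at \<open>\<theta>\<^sub>0\<close>, splits the integrand into a multiple of the
  covariance integrand and a difference of two densities, each of total mass 1.\<close>

lemma perturbed_score_integral:
  assumes f: "prob_density_on \<X> f"
    and g: "prob_density_on \<X> (\<lambda>x. \<psi> x \<theta>)" and h: "prob_density_on \<X> (\<lambda>x. \<psi> x \<theta>\<^sub>0)"
    and fin: "score_cov_diag \<X> f \<psi> \<theta> < \<infinity>" and fin0: "score_cov_diag \<X> f \<psi> \<theta>\<^sub>0 < \<infinity>"
  shows "has_bochner_integral (restrict_space lborel \<X>)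
      (\<lambda>x. perturbed f \<psi> \<eta> \<theta>\<^sub>0 x * (\<psi> x \<theta> / f x - 1)) (\<eta> * score_cov \<X> f \<psi> \<theta> \<theta>\<^sub>0)"
proof -
  let ?N = "restrict_space lborel \<X>"
  note [measurable] = prob_density_onD(1)[OF f] prob_density_onD(1)[OF g] prob_density_onD(1)[OF h]
  have *: "has_bochner_integral ?N
      (\<lambda>x. \<eta> * ((\<psi> x \<theta> - f x) * (\<psi> x \<theta>\<^sub>0 - f x) / f x) + (\<psi> x \<theta> - f x))
      (\<eta> * score_cov \<X> f \<psi> \<theta> \<theta>\<^sub>0)"
    using score_cov_integrable[OF f g h fin fin0] prob_density_onD(3,4)[OF f] prob_density_onD(3,4)[OF g]
    by (simp add: has_bochner_integral_iff score_cov_def del: times_divide_eq_right)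
  have ae: "AE x in ?N. perturbed f \<psi> \<eta> \<theta>\<^sub>0 x * (\<psi> x \<theta> / f x - 1)
      = \<eta> * ((\<psi> x \<theta> - f x) * (\<psi> x \<theta>\<^sub>0 - f x) / f x) + (\<psi> x \<theta> - f x)"
    using score_cov_diag_finiteD(1)[OF f g fin] score_cov_diag_finiteD(1)[OF f h fin0]
  proof eventually_elim
    \<comment> \<open>If \<open>f x = 0\<close>, division by zero leaves
      \<open>- \<eta> * \<psi> x \<theta>\<^sub>0\<close> on the left and
      \<open>\<psi> x \<theta>\<close> on the right. Both vanish because almost everywhere both
      perturbation densities are zero there.\<close>
    case (elim x)
    then show ?case by (cases "f x = 0") (auto simp: perturbed_def field_simps)
  qed
  show ?thesis
    by (rule has_bochner_integral_cong_AE[OF _ _ ae, THEN iffD2, OF _ _ *])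
      (simp_all add: perturbed_def)
qed

text \<open>This serves the off-diagonal terms of the product of two scores, where different
  functions are applied to two distinct observations.\<close>

lemma (in prob_space) indep_vars_pair_integral:
  fixes Y Z :: "'b \<Rightarrow> real"
  assumes ind: "indep_vars (\<lambda>_. N) X I" and ij: "i \<in> I" "j \<in> I" "i \<noteq> j"
    and [measurable]: "Y \<in> borel_measurable N" "Z \<in> borel_measurable N"
    and int: "integrable M (\<lambda>\<omega>. Y (X i \<omega>))" "integrable M (\<lambda>\<omega>. Z (X j \<omega>))"
  shows "has_bochner_integral M (\<lambda>\<omega>. Y (X i \<omega>) * Z (X j \<omega>))
      ((\<integral>\<omega>. Y (X i \<omega>) \<partial>M) * (\<integral>\<omega>. Z (X j \<omega>) \<partial>M))"
proof -
  \<comment> \<open>Choosing the function by index turns the pair into one family over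
    \<open>{i, j}\<close>, so that the product rule for finite independent families applies;
    \<open>i \<noteq> j\<close> ensures that index \<open>j\<close> receives
    \<open>Z\<close>.\<close>
  define W where "W = (\<lambda>k. if k = i then Y else Z)"
  have W: "W k \<in> borel_measurable N" for k
    by (simp add: W_def)
  have "indep_vars (\<lambda>_. N) X {i, j}"
    using ind ij by (auto intro: indep_vars_subset)
  then have iv: "indep_vars (\<lambda>_. borel) (\<lambda>k \<omega>. W k (X k \<omega>)) {i, j}"
    by (rule indep_vars_compose2) (rule W)
  have Wint: "integrable M (\<lambda>\<omega>. W k (X k \<omega>))" if "k \<in> {i, j}" for k
    using that int ij by (auto simp: W_def)
  show ?thesis
    using indep_vars_integrable[OF _ iv Wint] indep_vars_lebesgue_integral[OF _ iv Wint] ij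
    by (simp add: has_bochner_integral_iff W_def)
qed

text \<open>The density of \<open>X i\<close> transfers the single-term integral from the sample
  space to \<open>M\<close>; the second claim then follows by linearity from \<open>n\<close> equal
  means.\<close>

lemma iid_sample_score_expectation:
  fixes X :: "nat \<Rightarrow> '\<omega> \<Rightarrow> 'a::euclidean_space"
  assumes f: "prob_density_on \<X> f"
    and g: "prob_density_on \<X> (\<lambda>x. \<psi> x \<theta>)" and h: "prob_density_on \<X> (\<lambda>x. \<psi> x \<theta>\<^sub>0)"
    and fin: "score_cov_diag \<X> f \<psi> \<theta> < \<infinity>" and fin0: "score_cov_diag \<X> f \<psi> \<theta>\<^sub>0 < \<infinity>"
    and eta: "0 \<le> \<eta>" "\<eta> \<le> 1"
    and X: "iid_sample M \<X> (perturbed f \<psi> \<eta> \<theta>\<^sub>0) n X"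
  shows "i \<in> {1..n} \<Longrightarrow> has_bochner_integral M (\<lambda>\<omega>. \<psi> (X i \<omega>) \<theta> / f (X i \<omega>) - 1)
      (\<eta> * score_cov \<X> f \<psi> \<theta> \<theta>\<^sub>0)"
    and "has_bochner_integral M (score f \<psi> n X \<theta>) (real n * \<eta> * score_cov \<X> f \<psi> \<theta> \<theta>\<^sub>0)"
proof -
  let ?N = "restrict_space lborel \<X>"
  note [measurable] = prob_density_onD(1)[OF f] prob_density_onD(1)[OF g]
  \<comment> \<open>The density enters \<open>distributed\<close> through \<open>ennreal\<close>,
    which sends negative values to 0. The range of \<eta> makes the mixture nonnegative, so the real
    integrals against it are the expectations.\<close>
  have p: "0 \<le> perturbed f \<psi> \<eta> \<theta>\<^sub>0 x" if "x \<in> space ?N" for x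
    using that eta prob_density_onD(2)[OF f] prob_density_onD(2)[OF h]
    by (auto simp: perturbed_def space_restrict_space)
  show *: "has_bochner_integral M (\<lambda>\<omega>. \<psi> (X i \<omega>) \<theta> / f (X i \<omega>) - 1)
      (\<eta> * score_cov \<X> f \<psi> \<theta> \<theta>\<^sub>0)" if i: "i \<in> {1..n}" for i
  proof -
    have D: "distributed M ?N (X i) (\<lambda>x. ennreal (perturbed f \<psi> \<eta> \<theta>\<^sub>0 x))"
      using X i by (simp add: iid_sample_def)
    have "(\<lambda>x. \<psi> x \<theta> / f x - 1) \<in> borel_measurable ?N"
      by measurable
    from distributed_integrable[OF D this p] distributed_integral[OF D this p]
      perturbed_score_integral[OF f g h fin fin0, of \<eta>]
    show ?thesis
      by (simp add: has_bochner_integral_iff)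
  qed
  have "has_bochner_integral M (\<lambda>\<omega>. \<Sum>i=1..n. \<psi> (X i \<omega>) \<theta> / f (X i \<omega>) - 1)
      (\<Sum>i=1..n. \<eta> * score_cov \<X> f \<psi> \<theta> \<theta>\<^sub>0)"
    using * by (rule has_bochner_integral_sum)
  then show "has_bochner_integral M (score f \<psi> n X \<theta>) (real n * \<eta> * score_cov \<X> f \<psi> \<theta> \<theta>\<^sub>0)"
    by (simp add: score_def[abs_def] mult.assoc)
qed

text \<open>Scores are centred under the null density, so this second moment is their covariance;
  its integrability comes with it.\<close>

lemma iid_sample_score_product:
  fixes X :: "nat \<Rightarrow> '\<omega> \<Rightarrow> 'a::euclidean_space"
  assumes f: "prob_density_on \<X> f"
    and g: "prob_density_on \<X> (\<lambda>x. \<psi> x \<theta>)" and h: "prob_density_on \<X> (\<lambda>x. \<psi> x \<theta>')"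
    and fin: "score_cov_diag \<X> f \<psi> \<theta> < \<infinity>" and fin': "score_cov_diag \<X> f \<psi> \<theta>' < \<infinity>"
    and M: "prob_space M"
    and X: "iid_sample M \<X> f n X"
  shows "has_bochner_integral M (\<lambda>\<omega>. score f \<psi> n X \<theta> \<omega> * score f \<psi> n X \<theta>' \<omega>)
      (real n * score_cov \<X> f \<psi> \<theta> \<theta>')"
proof -
  interpret prob_space M by fact
  let ?N = "restrict_space lborel \<X>"
  note [measurable] = prob_density_onD(1)[OF f] prob_density_onD(1)[OF g] prob_density_onD(1)[OF h]
  define r where "r = (\<lambda>t x. \<psi> x t / f x - 1)"
  have r[measurable]: "r \<theta> \<in> borel_measurable ?N" "r \<theta>' \<in> borel_measurable ?N"
    unfolding r_def by measurable
  have nn: "0 \<le> f x" if "x \<in> space ?N" for x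
    using that prob_density_onD(2)[OF f] by (auto simp: space_restrict_space)
  \<comment> \<open>At \<open>\<eta> = 0\<close> the mixture is \<open>f\<close> for every
    \<open>t\<close>, so the mean formula can be applied with \<open>t\<close> equal to \<theta> or
    \<theta>' and gives 0.\<close>
  have X0: "iid_sample M \<X> (perturbed f \<psi> 0 t) n X" for t
    using X by (simp add: perturbed_def[abs_def])
  have mean: "has_bochner_integral M (\<lambda>\<omega>. r \<theta> (X i \<omega>)) 0"
      "has_bochner_integral M (\<lambda>\<omega>. r \<theta>' (X i \<omega>)) 0" if "i \<in> {1..n}" for i
    using iid_sample_score_expectation(1)[OF f g g fin fin _ _ X0 that]
      iid_sample_score_expectation(1)[OF f h h fin' fin' _ _ X0 that]
    by (simp_all add: r_def)
  have "has_bochner_integral M (\<lambda>\<omega>. r \<theta> (X i \<omega>) * r \<theta>' (X j \<omega>))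
      (if i = j then score_cov \<X> f \<psi> \<theta> \<theta>' else 0)"
    if ij: "i \<in> {1..n}" "j \<in> {1..n}" for i j
  proof (cases "i = j")
    case True
    have D: "distributed M ?N (X i) (\<lambda>x. ennreal (f x))"
      using X ij by (simp add: iid_sample_def)
    \<comment> \<open>Both sides vanish where \<open>f x = 0\<close>, since \<open>x / 0 = 0\<close>.\<close>
    have "(\<lambda>x. f x * (r \<theta> x * r \<theta>' x)) = (\<lambda>x. (\<psi> x \<theta> - f x) * (\<psi> x \<theta>' - f x) / f x)"
      by (auto simp: r_def fun_eq_iff field_simps)
    moreover have "(\<lambda>x. r \<theta> x * r \<theta>' x) \<in> borel_measurable ?N"
      by measurable
    note distributed_integrable[OF D this nn] distributed_integral[OF D this nn]
    ultimately show ?thesis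
      using score_cov_integrable[OF f g h fin fin'] True
      by (simp add: has_bochner_integral_iff score_cov_def)
  next
    case False
    have "indep_vars (\<lambda>_. ?N) X {1..n}"
      using X by (simp add: iid_sample_def)
    from indep_vars_pair_integral[OF this ij False r] mean(1)[OF ij(1)] mean(2)[OF ij(2)] False
    show ?thesis
      by (simp add: has_bochner_integral_iff)
  qed
  then have "has_bochner_integral M (\<lambda>\<omega>. \<Sum>i=1..n. \<Sum>j=1..n. r \<theta> (X i \<omega>) * r \<theta>' (X j \<omega>))
      (\<Sum>i=1..n. \<Sum>j=1..n. if i = j then score_cov \<X> f \<psi> \<theta> \<theta>' else 0)"
    by (intro has_bochner_integral_sum) auto
  \<comment> \<open>Multiplying out the two sums gives the double sum, in which only the
    \<open>n\<close> diagonal terms contribute.\<close>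
  then show ?thesis
    by (simp add: score_def r_def sum_product)
qed

theorem theorem1:
  fixes \<X> :: "(real ^ 's) set"
    and \<Theta> :: "(real ^ 'd) set"
    and f :: "real ^ 's \<Rightarrow> real"
    and \<psi> :: "real ^ 's \<Rightarrow> real ^ 'd \<Rightarrow> real"
    and M :: "'\<omega> measure"
    and X :: "nat \<Rightarrow> '\<omega> \<Rightarrow> real ^ 's"
    and n :: nat
    and \<eta> :: real
    and \<theta>\<^sub>0 :: "real ^ 'd"
  assumes "\<X> \<in> sets borel"
    and "prob_density_on \<X> f"
    and "\<And>\<theta>. \<theta> \<in> \<Theta> \<Longrightarrow> prob_density_on \<X> (\<lambda>x. \<psi> x \<theta>)"
    and "\<And>\<theta>. \<theta> \<in> \<Theta> \<Longrightarrow> score_cov_diag \<X> f \<psi> \<theta> < \<infinity>"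
    and "\<And>\<theta>. \<theta> \<in> \<Theta> \<Longrightarrow> density_supp \<X> (\<lambda>x. \<psi> x \<theta>) \<subseteq> density_supp \<X> f"
    and "0 \<le> \<eta>" and "\<eta> \<le> 1" and "\<theta>\<^sub>0 \<in> \<Theta>"
    and "1 \<le> n"
    and "prob_space M"
    and "iid_sample M \<X> (perturbed f \<psi> \<eta> \<theta>\<^sub>0) n X"
  shows
    "(\<eta> = 0 \<longrightarrow>
        (\<forall>\<theta>\<in>\<Theta>. integrable M (score f \<psi> n X \<theta>) \<and>
           (\<integral>\<omega>. score f \<psi> n X \<theta> \<omega> \<partial>M) = 0) \<and>
        (\<forall>\<theta>\<in>\<Theta>. \<forall>\<theta>'\<in>\<Theta>.
           integrable M (\<lambda>\<omega>. score f \<psi> n X \<theta> \<omega> * score f \<psi> n X \<theta>' \<omega>) \<and>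
           covariance M (score f \<psi> n X \<theta>) (score f \<psi> n X \<theta>') =
             real n * score_cov \<X> f \<psi> \<theta> \<theta>')) \<and>
     (0 < \<eta> \<longrightarrow>
        (\<forall>\<theta>\<in>\<Theta>. integrable M (score f \<psi> n X \<theta>) \<and>
           (\<integral>\<omega>. score f \<psi> n X \<theta> \<omega> \<partial>M) = real n * \<eta> * score_cov \<X> f \<psi> \<theta> \<theta>\<^sub>0)) \<and>
     (0 < \<eta> \<longrightarrow>
        (\<forall>\<theta>\<in>\<Theta>. 0 < score_cov \<X> f \<psi> \<theta> \<theta> \<longrightarrow>
           integrable M (norm_score \<X> f \<psi> n X \<theta>) \<and>
           (\<integral>\<omega>. norm_score \<X> f \<psi> n X \<theta> \<omega> \<partial>M) =
             sqrt (real n) * \<eta> * (score_cov \<X> f \<psi> \<theta> \<theta>\<^sub>0 / sqrt (score_cov \<X> f \<psi> \<theta> \<theta>)) \<and>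
           sqrt (real n) * \<eta> * (score_cov \<X> f \<psi> \<theta> \<theta>\<^sub>0 / sqrt (score_cov \<X> f \<psi> \<theta> \<theta>))
             \<le> \<eta> * sqrt (real n * score_cov \<X> f \<psi> \<theta>\<^sub>0 \<theta>\<^sub>0)) \<and>
        (0 < score_cov \<X> f \<psi> \<theta>\<^sub>0 \<theta>\<^sub>0 \<longrightarrow>
           (\<integral>\<omega>. norm_score \<X> f \<psi> n X \<theta>\<^sub>0 \<omega> \<partial>M) =
             \<eta> * sqrt (real n * score_cov \<X> f \<psi> \<theta>\<^sub>0 \<theta>\<^sub>0)))"
proof -
  note f = assms(2) and g = assms(3) and fin = assms(4) and \<theta>\<^sub>0 = \<open>\<theta>\<^sub>0 \<in> \<Theta>\<close>
  let ?C = "score_cov \<X> f \<psi>"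
  have E: "has_bochner_integral M (score f \<psi> n X \<theta>) (real n * \<eta> * ?C \<theta> \<theta>\<^sub>0)" if "\<theta> \<in> \<Theta>" for \<theta>
    using iid_sample_score_expectation(2)[OF f g[OF that] g[OF \<theta>\<^sub>0] fin[OF that] fin[OF \<theta>\<^sub>0]] assms
    by blast
  have N: "has_bochner_integral M (norm_score \<X> f \<psi> n X \<theta>)
      (sqrt (real n) * \<eta> * (?C \<theta> \<theta>\<^sub>0 / sqrt (?C \<theta> \<theta>)))" if "\<theta> \<in> \<Theta>" for \<theta>
  proof -
    \<comment> \<open>The normalization is deterministic, so it divides the mean;
      \<open>n / sqrt n\<close> leaves the growth rate \<open>sqrt n\<close>. Where
      \<open>?C \<theta> \<theta> = 0\<close>, both sides are 0 by division by zero.\<close>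
    have "real n * \<eta> * ?C \<theta> \<theta>\<^sub>0 / sqrt (real n * ?C \<theta> \<theta>)
        = real n / sqrt (real n) * \<eta> * (?C \<theta> \<theta>\<^sub>0 / sqrt (?C \<theta> \<theta>))"
      by (simp add: real_sqrt_mult)
    also have "\<dots> = sqrt (real n) * \<eta> * (?C \<theta> \<theta>\<^sub>0 / sqrt (?C \<theta> \<theta>))"
      by (simp add: real_div_sqrt)
    finally show ?thesis
      using E[OF that] by (simp add: norm_score_def[abs_def] has_bochner_integral_iff)
  qed
  have bound: "sqrt (real n) * \<eta> * (?C \<theta> \<theta>\<^sub>0 / sqrt (?C \<theta> \<theta>)) \<le> \<eta> * sqrt (real n * ?C \<theta>\<^sub>0 \<theta>\<^sub>0)"
    if \<theta>: "\<theta> \<in> \<Theta>" and pos: "0 < ?C \<theta> \<theta>" for \<theta>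
  proof -
    \<comment> \<open>The bound on the square suffices for either sign of
      \<open>?C \<theta> \<theta>\<^sub>0\<close>.\<close>
    have "?C \<theta> \<theta>\<^sub>0 \<le> sqrt (?C \<theta> \<theta> * ?C \<theta>\<^sub>0 \<theta>\<^sub>0)"
      by (intro real_le_rsqrt score_cov_Cauchy_Schwarz f g fin \<theta> \<theta>\<^sub>0 pos)
    then have "?C \<theta> \<theta>\<^sub>0 / sqrt (?C \<theta> \<theta>) \<le> sqrt (?C \<theta>\<^sub>0 \<theta>\<^sub>0)"
      using pos by (simp add: real_sqrt_mult pos_divide_le_eq mult.commute)
    then have "sqrt (real n) * \<eta> * (?C \<theta> \<theta>\<^sub>0 / sqrt (?C \<theta> \<theta>)) \<le> sqrt (real n) * \<eta> * sqrt (?C \<theta>\<^sub>0 \<theta>\<^sub>0)"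
      using \<open>0 \<le> \<eta>\<close> by (intro mult_left_mono) auto
    then show ?thesis
      by (simp add: real_sqrt_mult mult_ac)
  qed
  have eq: "sqrt (real n) * \<eta> * (?C \<theta>\<^sub>0 \<theta>\<^sub>0 / sqrt (?C \<theta>\<^sub>0 \<theta>\<^sub>0)) = \<eta> * sqrt (real n * ?C \<theta>\<^sub>0 \<theta>\<^sub>0)"
    if "0 < ?C \<theta>\<^sub>0 \<theta>\<^sub>0"
    using that by (simp add: real_div_sqrt real_sqrt_mult)
  have P: "has_bochner_integral M (\<lambda>\<omega>. score f \<psi> n X \<theta> \<omega> * score f \<psi> n X \<theta>' \<omega>)
      (real n * ?C \<theta> \<theta>')" if "\<eta> = 0" "\<theta> \<in> \<Theta>" "\<theta>' \<in> \<Theta>" for \<theta> \<theta>'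
  proof (rule iid_sample_score_product)
    show "iid_sample M \<X> f n X"
      using assms(11) \<open>\<eta> = 0\<close> by (simp add: perturbed_def[abs_def])
  qed (use that assms in auto)
  \<comment> \<open>For \<open>\<eta> = 0\<close>, \<open>E\<close> gives mean 0, so the centred
    product in \<open>covariance\<close> reduces to the product treated by \<open>P\<close>.\<close>
  show ?thesis
    using E N bound eq P \<theta>\<^sub>0 by (simp add: has_bochner_integral_iff covariance_def)
qed

end
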